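(* Let $p\in(0,1)$ and $q\subseteq\omega$. If $\mu_p(\{A\in 2^\omega: A\ge_{\mathrm T} q\})=1$, then $q\le_{\mathrm T} p$.
   Context: $\mu_p$ is the Bernoulli product measure on $2^\omega$ (independent bits, each equal to $1$ with probability $p$). Turing reducibility to $p$ means reducibility to (the binary expansion of) the real $p$. *)

theory Defs
  imports "HOL-Probability.Probability"
begin

text \<open>
  Kleene's partial functions recursive in an oracle: the smallest class containing the basic
  functions and the characteristic function of the oracle that is closed under composition,
  primitive recursion and unbounded minimisation. A term does not carry an arity; it denotes one
  partial function of k arguments for every length k of the argument list.
\<close>

datatype recf =
    Zero
  | Succ
  | Proj nat
  | Oracle
  | Comp recf "recf list"
  | PrimRec recf recf
  | Mu recf

inductive eval :: "nat set \<Rightarrow> recf \<Rightarrow> nat list \<Rightarrow> nat \<Rightarrow> bool" for B :: "nat set" where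
  Zero: "eval B Zero xs 0"
| Succ: "eval B Succ [x] (Suc x)"
| Proj: "i < length xs \<Longrightarrow> eval B (Proj i) xs (xs ! i)"
| Oracle: "eval B Oracle [x] (of_bool (x \<in> B))"
| Comp: "list_all2 (\<lambda>g y. eval B g xs y) gs ys \<Longrightarrow> eval B f ys z \<Longrightarrow> eval B (Comp f gs) xs z"
| PrimRec_0: "eval B f xs y \<Longrightarrow> eval B (PrimRec f g) (0 # xs) y"
| PrimRec_Suc: "eval B (PrimRec f g) (n # xs) y \<Longrightarrow> eval B g (n # y # xs) z \<Longrightarrow>
    eval B (PrimRec f g) (Suc n # xs) z"
| Mu: "eval B f (n # xs) 0 \<Longrightarrow> (\<forall>m<n. \<exists>y. eval B f (m # xs) (Suc y)) \<Longrightarrow> eval B (Mu f) xs n"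

definition turing_reducible :: "nat set \<Rightarrow> nat set \<Rightarrow> bool"  (infix \<open>\<le>\<^sub>T\<close> 50) where
  "A \<le>\<^sub>T B \<longleftrightarrow> (\<exists>f. \<forall>n. eval B f [n] (of_bool (n \<in> A)))"

inductive_cases eval_ZeroE: "eval B Zero xs y"
inductive_cases eval_SuccE: "eval B Succ xs y"
inductive_cases eval_ProjE: "eval B (Proj i) xs y"
inductive_cases eval_OracleE: "eval B Oracle xs y"
inductive_cases eval_CompE: "eval B (Comp f gs) xs y"
inductive_cases eval_PrimRec_0E: "eval B (PrimRec f g) (0 # xs) y"
inductive_cases eval_PrimRec_SucE: "eval B (PrimRec f g) (Suc n # xs) y"
inductive_cases eval_MuE: "eval B (Mu f) xs y"

lemma eval_deterministic: "eval B f xs y \<Longrightarrow> eval B f xs z \<Longrightarrow> y = z"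
proof (induction arbitrary: z rule: eval.induct)
  case (Zero xs)
  then show ?case by (auto elim: eval_ZeroE)
next
  case (Succ x)
  then show ?case by (auto elim: eval_SuccE)
next
  case (Proj i xs)
  from Proj.prems show ?case by (auto elim: eval_ProjE)
next
  case (Oracle x)
  then show ?case by (auto elim: eval_OracleE)
next
  case (Comp xs gs ys f w)
  from Comp.prems obtain ys' where ys': "list_all2 (\<lambda>g y. eval B g xs y) gs ys'" "eval B f ys' z"
    by (rule eval_CompE)
  have "ys = ys'"
    using Comp.IH(1) ys'(1) by (auto simp: list_all2_conv_all_nth intro!: nth_equalityI)
  with ys' Comp.IH(2) show ?case by blast
next
  case (PrimRec_0 f xs y g)
  from PrimRec_0.prems show ?case by (rule eval_PrimRec_0E) (rule PrimRec_0.IH)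
next
  case (PrimRec_Suc f g n xs y w)
  from PrimRec_Suc.prems obtain y' where
    "eval B (PrimRec f g) (n # xs) y'" "eval B g (n # y' # xs) z"
    by (rule eval_PrimRec_SucE)
  with PrimRec_Suc.IH show ?case by blast
next
  case (Mu f n xs)
  from Mu.prems have z: "eval B f (z # xs) 0" "\<forall>m<z. \<exists>y. eval B f (m # xs) (Suc y)"
    by (rule eval_MuE, simp)+
  show ?case
  proof (rule linorder_cases[of n z])
    assume "n < z"
    with z(2) obtain y where "eval B f (n # xs) (Suc y)" by blast
    with Mu.IH(1) show ?thesis by blast
  next
    assume "z < n"
    with Mu.IH(2) obtain y where "\<And>w. eval B f (z # xs) w \<Longrightarrow> Suc y = w" by blast
    with z(1) show ?thesis by blast
  qed
qed

lemma turing_reducible_refl: "A \<le>\<^sub>T A"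
  unfolding turing_reducible_def by (blast intro: eval.Oracle)

fun subst_oracle :: "recf \<Rightarrow> recf \<Rightarrow> recf" where
  "subst_oracle h Oracle = h"
| "subst_oracle h (Comp f gs) = Comp (subst_oracle h f) (map (subst_oracle h) gs)"
| "subst_oracle h (PrimRec f g) = PrimRec (subst_oracle h f) (subst_oracle h g)"
| "subst_oracle h (Mu f) = Mu (subst_oracle h f)"
| "subst_oracle h f = f"

lemma eval_subst_oracle:
  assumes h: "\<And>n. eval C h [n] (of_bool (n \<in> B))"
  shows "eval B f xs y \<Longrightarrow> eval C (subst_oracle h f) xs y"
proof (induction rule: eval.induct)
  case (Comp xs gs ys f z)
  then have "list_all2 (\<lambda>g y. eval C g xs y) (map (subst_oracle h) gs) ys"
    by (auto simp: list_all2_conv_all_nth)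
  with Comp.IH(2) show ?case by (simp add: eval.Comp)
next
  case (Oracle x)
  show ?case using h by simp
next
  case (Mu f n xs)
  then show ?case by (simp, intro eval.Mu) auto
next
  case (PrimRec_Suc f g n xs y z)
  then show ?case by (simp, intro eval.PrimRec_Suc)
qed (simp_all add: eval.Zero eval.Succ eval.Proj eval.PrimRec_0)

lemma turing_reducible_trans: "A \<le>\<^sub>T B \<Longrightarrow> B \<le>\<^sub>T C \<Longrightarrow> A \<le>\<^sub>T C"
  unfolding turing_reducible_def using eval_subst_oracle by meson

definition bernoulli_measure :: "real \<Rightarrow> (nat \<Rightarrow> bool) measure" where
  "bernoulli_measure p = PiM UNIV (\<lambda>_. measure_pmf (bernoulli_pmf p))"

text \<open>
  Place n carries the weight 1/2^(n+1). For a dyadic rational this is the expansion ending in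
  zeros; the other one is cofinite, so both are computable and the Turing degree is the same.
\<close>

definition binary_expansion :: "real \<Rightarrow> nat set" where
  "binary_expansion x = {n. odd \<lfloor>2 ^ Suc n * x\<rfloor>}"

lemma binary_expansion_sums:
  assumes "0 \<le> x" "x < 1"
  shows "(\<lambda>n. of_bool (n \<in> binary_expansion x) / 2 ^ Suc n) sums x"
proof -
  have step: "\<lfloor>2 * y\<rfloor> = 2 * \<lfloor>y\<rfloor> + of_bool (odd \<lfloor>2 * y\<rfloor>)" for y :: real
  proof -
    have "\<lfloor>2 * y\<rfloor> = 2 * \<lfloor>y\<rfloor> \<or> \<lfloor>2 * y\<rfloor> = 2 * \<lfloor>y\<rfloor> + 1" by linarith
    then show ?thesis by auto
  qed
  have partial: "(\<Sum>i<n. of_bool (i \<in> binary_expansion x) / 2 ^ Suc i) = real_of_int \<lfloor>2 ^ n * x\<rfloor> / 2 ^ n" for n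
  proof (induction n)
    case 0
    with assms have "\<lfloor>x\<rfloor> = 0" by linarith
    then show ?case by simp
  next
    case (Suc n)
    have "real_of_int \<lfloor>2 ^ Suc n * x\<rfloor> =
        2 * real_of_int \<lfloor>2 ^ n * x\<rfloor> + of_bool (n \<in> binary_expansion x)"
      using arg_cong[OF step[of "2 ^ n * x"], of real_of_int]
      by (simp add: binary_expansion_def mult.assoc)
    then show ?case using Suc by (simp add: field_simps del: power_Suc) (simp add: field_simps)
  qed
  have "(\<lambda>n. real_of_int \<lfloor>2 ^ n * x\<rfloor> / 2 ^ n) \<longlonglongrightarrow> x"
  proof (rule tendsto_sandwich[of "\<lambda>n. x - (1/2) ^ n" _ _ "\<lambda>_. x"])
    show "\<forall>\<^sub>F n in sequentially. x - (1/2) ^ n \<le> real_of_int \<lfloor>2 ^ n * x\<rfloor> / 2 ^ n"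
    proof (rule always_eventually, rule allI)
      fix n :: nat
      have "2 ^ n * x - 1 \<le> real_of_int \<lfloor>2 ^ n * x\<rfloor>" by linarith
      then have "(2 ^ n * x - 1) / 2 ^ n \<le> real_of_int \<lfloor>2 ^ n * x\<rfloor> / 2 ^ n"
        by (rule divide_right_mono) simp
      then show "x - (1/2) ^ n \<le> real_of_int \<lfloor>2 ^ n * x\<rfloor> / 2 ^ n"
        by (simp add: diff_divide_distrib power_one_over)
    qed
    show "\<forall>\<^sub>F n in sequentially. real_of_int \<lfloor>2 ^ n * x\<rfloor> / 2 ^ n \<le> x"
      by (rule always_eventually) (simp add: field_simps)
    show "(\<lambda>n. x - (1/2) ^ n) \<longlonglongrightarrow> x"
      using tendsto_diff[OF tendsto_const LIMSEQ_power_zero[of "1/2::real"], of x] by simp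
  qed simp
  then show ?thesis unfolding sums_def partial .
qed

end

theory Submission imports Defs "HOL-Real_Asymp.Real_Asymp"
begin

text \<open>
  This is Sacks' majority vote, carried out for a Bernoulli measure. Since there are only countably
  many functionals, a single one, \<open>f\<close>, computes \<open>q\<close> from every \<open>A\<close> in a set \<open>S\<close> of measure
  \<open>\<delta> > 0\<close>. Approximate \<open>S\<close> up to \<open>\<delta> / 3\<close> by a clopen set \<open>C\<close> and fix a rational \<open>\<theta>\<close> between
  \<open>\<delta> / 3\<close> and \<open>2 \<delta> / 3\<close>. Among the oracles in \<open>C\<close>, those giving the right answer at \<open>n\<close> have
  measure above \<open>\<theta>\<close> and those giving the wrong one have measure below \<open>\<theta>\<close>. Hence \<open>q\<close> is found by
  searching for a finite set of strings in \<open>C\<close> that agree on the answer and whose measure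
  exceeds \<open>\<theta>\<close>; the measure of a finite set of strings is computable from below relative to \<open>p\<close>.
  No universal machine is needed, because \<open>f\<close> is fixed: its bounded approximations are shown
  to be recursive by induction on \<open>f\<close>.
\<close>

section \<open>Functions recursive in an oracle\<close>

text \<open>Terms carry no arity, so \<open>k\<close> fixes the length at which a term has to
  compute \<open>F\<close>. Values of \<open>F\<close> at other lengths are irrelevant, which lets
  \<open>F\<close> be any expression in \<open>xs ! i\<close>. Only total functions are covered;
  predicates enter through \<open>of_bool\<close>.\<close>

definition recursive_in :: "nat set \<Rightarrow> nat \<Rightarrow> (nat list \<Rightarrow> nat) \<Rightarrow> bool" where
  "recursive_in B k F \<longleftrightarrow> (\<exists>f. \<forall>xs. length xs = k \<longrightarrow> eval B f xs (F xs))"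

lemma recursive_in_cong:
  assumes "recursive_in B k F" and "\<And>xs. length xs = k \<Longrightarrow> F xs = G xs"
  shows "recursive_in B k G"
  using assms unfolding recursive_in_def by metis

lemma recursive_in_nth: "i < k \<Longrightarrow> recursive_in B k (\<lambda>xs. xs ! i)"
  unfolding recursive_in_def by (blast intro: eval.Proj)

lemma recursive_in_comp:
  assumes F: "recursive_in B (length Gs) F" and Gs: "\<And>G. G \<in> set Gs \<Longrightarrow> recursive_in B k G"
  shows "recursive_in B k (\<lambda>xs. F (map (\<lambda>G. G xs) Gs))"
proof -
  obtain f where f: "\<And>xs. length xs = length Gs \<Longrightarrow> eval B f xs (F xs)"
    using F unfolding recursive_in_def by blast
  have "\<exists>g. \<forall>xs. length xs = k \<longrightarrow> eval B g xs (G xs)" if "G \<in> set Gs" for G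
    using Gs[OF that] unfolding recursive_in_def .
  then obtain h where h: "\<And>G xs. G \<in> set Gs \<Longrightarrow> length xs = k \<Longrightarrow> eval B (h G) xs (G xs)"
    by metis
  have "eval B (Comp f (map h Gs)) xs (F (map (\<lambda>G. G xs) Gs))" if "length xs = k" for xs
    by (rule eval.Comp[where ys = "map (\<lambda>G. G xs) Gs"])
      (use h f that in \<open>auto simp: list_all2_conv_all_nth\<close>)
  then show ?thesis unfolding recursive_in_def by blast
qed

lemma recursive_in_Suc:
  assumes "recursive_in B k F"
  shows "recursive_in B k (\<lambda>xs. Suc (F xs))"
proof -
  have "recursive_in B (length [F]) (\<lambda>ys. Suc (ys ! 0))"
    unfolding recursive_in_def by (rule exI[of _ Succ]) (auto simp: length_Suc_conv intro: eval.Succ)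
  from recursive_in_comp[OF this, of k] assms show ?thesis by simp
qed

lemma recursive_in_oracle:
  assumes "recursive_in B k F"
  shows "recursive_in B k (\<lambda>xs. of_bool (F xs \<in> B))"
proof -
  have "recursive_in B (length [F]) (\<lambda>ys. of_bool (ys ! 0 \<in> B))"
    unfolding recursive_in_def
    by (rule exI[of _ Oracle]) (metis One_nat_def eval.Oracle length_0_conv length_Cons length_Suc_conv list.size(3) nth_Cons_0)
  from recursive_in_comp[OF this, of k] assms show ?thesis by simp
qed

lemma recursive_in_const: "recursive_in B k (\<lambda>_. n)"
proof (induction n)
  case 0
  show ?case unfolding recursive_in_def by (blast intro: eval.Zero)
qed (rule recursive_in_Suc)

lemma drop_conv_map_nth: "length xs = j + k \<Longrightarrow> drop j xs = map (\<lambda>i. xs ! (j + i)) [0..<k]"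
  by (auto intro: nth_equalityI)

text \<open>Weakening: recursion and bounded sums put their own variables in front of the
  parameters, so a function of the parameters must be read off the tail.\<close>

lemma recursive_in_drop:
  assumes "recursive_in B k F"
  shows "recursive_in B (j + k) (\<lambda>xs. F (drop j xs))"
  by (rule recursive_in_cong,
      rule recursive_in_comp[where F = F and Gs = "map (\<lambda>i xs. xs ! (j + i)) [0..<k]"])
    (use assms in \<open>auto simp: drop_conv_map_nth comp_def intro: recursive_in_nth\<close>)

lemma recursive_in_drop2:
  "recursive_in B k F \<Longrightarrow> recursive_in B (Suc (Suc k)) (\<lambda>xs. F (drop 2 xs))"
  using recursive_in_drop[of B k F 2] by simp

text \<open>A loop body receives counter, accumulator and parameters; summands and factors want all
  but the accumulator.\<close>

lemma recursive_in_drop2_Cons: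
  assumes "recursive_in B (Suc k) F"
  shows "recursive_in B (Suc (Suc k)) (\<lambda>xs. F (xs ! 0 # drop 2 xs))"
  by (rule recursive_in_cong,
      rule recursive_in_comp[where F = F and Gs = "(\<lambda>xs. xs ! 0) # map (\<lambda>i xs. xs ! (2 + i)) [0..<k]"])
    (use assms in \<open>auto simp: drop_conv_map_nth comp_def intro: recursive_in_nth\<close>)

text \<open>\<open>PrimRec\<close> recurses on its first argument. Here the number of rounds is
  itself a function of the parameters, obtained by composing with \<open>N xs # xs\<close>; this is
  the form in which every loop below is built.\<close>

lemma recursive_in_rec_nat:
  assumes "recursive_in B k N" "recursive_in B k F" "recursive_in B (Suc (Suc k)) G"
  shows "recursive_in B k (\<lambda>xs. rec_nat (F xs) (\<lambda>n y. G (n # y # xs)) (N xs))"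
proof -
  obtain f where f: "\<And>xs. length xs = k \<Longrightarrow> eval B f xs (F xs)"
    using assms(2) unfolding recursive_in_def by blast
  obtain g where g: "\<And>xs. length xs = Suc (Suc k) \<Longrightarrow> eval B g xs (G xs)"
    using assms(3) unfolding recursive_in_def by blast
  have pr: "eval B (PrimRec f g) (n # xs) (rec_nat (F xs) (\<lambda>n y. G (n # y # xs)) n)" if "length xs = k" for n xs
    by (induction n) (use f g that in \<open>auto intro: eval.PrimRec_0 eval.PrimRec_Suc\<close>)
  have "recursive_in B (Suc k)
      (\<lambda>ys. rec_nat (F (tl ys)) (\<lambda>n y. G (n # y # tl ys)) (hd ys))" (is "recursive_in _ _ ?H")
    unfolding recursive_in_def
    by (rule exI[of _ "PrimRec f g"]) (auto simp: length_Suc_conv pr)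
  then have *: "recursive_in B k
      (\<lambda>xs. ?H (map (\<lambda>G. G xs) (N # map (\<lambda>i xs. xs ! i) [0..<k])))"
    by (intro recursive_in_comp) (auto intro: recursive_in_nth assms)
  have "map (\<lambda>G. G xs) (N # map (\<lambda>i xs. xs ! i) [0..<k]) = N xs # xs" if "length xs = k" for xs
    using that by (auto intro: nth_equalityI)
  then show ?thesis by (intro recursive_in_cong[OF *]) simp
qed

section \<open>Arithmetic, bounded sums and products, decidable predicates\<close>

lemma recursive_in_add:
  assumes "recursive_in B k F" "recursive_in B k G"
  shows "recursive_in B k (\<lambda>xs. F xs + G xs)"
proof -
  have "rec_nat x (\<lambda>_ y. Suc y) n = x + n" for x n :: nat by (induction n) auto
  moreover have "recursive_in B (Suc (Suc k)) (\<lambda>xs. Suc (xs ! 1))"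
    by (intro recursive_in_Suc recursive_in_nth) simp
  note recursive_in_rec_nat[OF assms(2,1) this]
  ultimately show ?thesis by simp
qed

lemma recursive_in_mult:
  assumes "recursive_in B k F" "recursive_in B k G"
  shows "recursive_in B k (\<lambda>xs. F xs * G xs)"
proof -
  have "rec_nat 0 (\<lambda>_ y. y + x) n = n * x" for x n :: nat by (induction n) auto
  moreover have "recursive_in B (Suc (Suc k)) (\<lambda>xs. xs ! 1 + G (drop 2 xs))"
    by (intro recursive_in_add recursive_in_drop2 recursive_in_nth assms) simp
  note recursive_in_rec_nat[OF assms(1) recursive_in_const[of _ _ 0] this]
  ultimately show ?thesis by simp
qed

lemma recursive_in_power:
  assumes "recursive_in B k F" "recursive_in B k G"
  shows "recursive_in B k (\<lambda>xs. F xs ^ G xs)"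
proof -
  have "rec_nat 1 (\<lambda>_ y. y * x) n = x ^ n" for x n :: nat by (induction n) auto
  moreover have "recursive_in B (Suc (Suc k)) (\<lambda>xs. xs ! 1 * F (drop 2 xs))"
    by (intro recursive_in_mult recursive_in_drop2 recursive_in_nth assms) simp
  note recursive_in_rec_nat[OF assms(2) recursive_in_const[of _ _ 1] this]
  ultimately show ?thesis by simp
qed

lemma recursive_in_pred:
  assumes "recursive_in B k F"
  shows "recursive_in B k (\<lambda>xs. F xs - 1)"
proof -
  have "rec_nat 0 (\<lambda>m _. m) n = n - 1" for n :: nat by (cases n) auto
  moreover have "recursive_in B (Suc (Suc k)) (\<lambda>xs. xs ! 0)"
    by (intro recursive_in_nth) simp
  note recursive_in_rec_nat[OF assms recursive_in_const[of _ _ 0] this]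
  ultimately show ?thesis by simp
qed

lemma recursive_in_diff:
  assumes "recursive_in B k F" "recursive_in B k G"
  shows "recursive_in B k (\<lambda>xs. F xs - G xs)"
proof -
  have "rec_nat x (\<lambda>_ y. y - 1) n = x - n" for x n :: nat by (induction n) auto
  moreover have "recursive_in B (Suc (Suc k)) (\<lambda>xs. xs ! 1 - 1)"
    by (intro recursive_in_pred recursive_in_nth) simp
  note recursive_in_rec_nat[OF assms(2,1) this]
  ultimately show ?thesis by simp
qed

lemma recursive_in_sum:
  assumes "recursive_in B k N" "recursive_in B (Suc k) F"
  shows "recursive_in B k (\<lambda>xs. \<Sum>i<N xs. F (i # xs))"
proof -
  have "rec_nat 0 (\<lambda>m y. y + h m) n = (\<Sum>i<n. h i)" for n and h :: "nat \<Rightarrow> nat"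
    by (induction n) auto
  moreover have "recursive_in B (Suc (Suc k)) (\<lambda>xs. xs ! 1 + F (xs ! 0 # drop 2 xs))"
    by (intro recursive_in_add recursive_in_drop2_Cons recursive_in_nth assms) simp
  note recursive_in_rec_nat[OF assms(1) recursive_in_const[of _ _ 0] this]
  ultimately show ?thesis by simp
qed

lemma recursive_in_prod:
  assumes "recursive_in B k N" "recursive_in B (Suc k) F"
  shows "recursive_in B k (\<lambda>xs. \<Prod>i<N xs. F (i # xs))"
proof -
  have "rec_nat 1 (\<lambda>m y. y * h m) n = (\<Prod>i<n. h i)" for n and h :: "nat \<Rightarrow> nat"
    by (induction n) auto
  moreover have "recursive_in B (Suc (Suc k)) (\<lambda>xs. xs ! 1 * F (xs ! 0 # drop 2 xs))"
    by (intro recursive_in_mult recursive_in_drop2_Cons recursive_in_nth assms) simp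
  note recursive_in_rec_nat[OF assms(1) recursive_in_const[of _ _ 1] this]
  ultimately show ?thesis by simp
qed

text \<open>Subtraction is truncated, so the difference is positive exactly when the inequality
  holds, and \<open>1 - (1 - d)\<close> cuts a positive \<open>d\<close> down to 1.\<close>

lemma recursive_in_less:
  assumes "recursive_in B k F" "recursive_in B k G"
  shows "recursive_in B k (\<lambda>xs. of_bool (F xs < G xs))"
  by (rule recursive_in_cong[where F = "\<lambda>xs. 1 - (1 - (G xs - F xs))"])
    (auto intro!: recursive_in_diff recursive_in_const assms simp: Suc_diff_Suc)

lemma recursive_in_not:
  assumes "recursive_in B k (\<lambda>xs. of_bool (P xs))"
  shows "recursive_in B k (\<lambda>xs. of_bool (\<not> P xs))"
  by (rule recursive_in_cong[where F = "\<lambda>xs. 1 - of_bool (P xs)"])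
    (auto intro!: recursive_in_diff recursive_in_const assms)

lemma recursive_in_conj:
  assumes "recursive_in B k (\<lambda>xs. of_bool (P xs))" "recursive_in B k (\<lambda>xs. of_bool (Q xs))"
  shows "recursive_in B k (\<lambda>xs. of_bool (P xs \<and> Q xs))"
  using recursive_in_mult[OF assms] by (simp flip: of_bool_conj)

lemma recursive_in_disj:
  assumes "recursive_in B k (\<lambda>xs. of_bool (P xs))" "recursive_in B k (\<lambda>xs. of_bool (Q xs))"
  shows "recursive_in B k (\<lambda>xs. of_bool (P xs \<or> Q xs))"
  using recursive_in_not[OF recursive_in_conj[OF assms[THEN recursive_in_not]]] by simp

lemma recursive_in_le:
  assumes "recursive_in B k F" "recursive_in B k G"
  shows "recursive_in B k (\<lambda>xs. of_bool (F xs \<le> G xs))"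
  using recursive_in_not[OF recursive_in_less[OF assms(2,1)]] by (simp add: not_less)

lemma recursive_in_eq:
  assumes "recursive_in B k F" "recursive_in B k G"
  shows "recursive_in B k (\<lambda>xs. of_bool (F xs = G xs))"
  using recursive_in_conj[OF recursive_in_le[OF assms] recursive_in_le[OF assms(2,1)]]
  by (simp flip: order_eq_iff)

lemma recursive_in_Bex_list:
  assumes "\<And>a. a \<in> set as \<Longrightarrow> recursive_in B k (\<lambda>xs. of_bool (P a xs))"
  shows "recursive_in B k (\<lambda>xs. of_bool (\<exists>a\<in>set as. P a xs))"
  using assms
proof (induction as)
  case Nil
  show ?case using recursive_in_const[of B k 0] by simp
next
  case (Cons a as)
  then show ?case using recursive_in_disj[of B k "P a"] by simp
qed

text \<open>Both branches are total, so a truth value can serve as their weight in a sum.\<close>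

lemma recursive_in_if:
  assumes "recursive_in B k (\<lambda>xs. of_bool (P xs))" "recursive_in B k F" "recursive_in B k G"
  shows "recursive_in B k (\<lambda>xs. if P xs then F xs else G xs)"
  by (rule recursive_in_cong[where F = "\<lambda>xs. of_bool (P xs) * F xs + (1 - of_bool (P xs)) * G xs"])
    (auto intro!: recursive_in_add recursive_in_mult recursive_in_diff recursive_in_const assms)

lemma recursive_in_div:
  assumes "recursive_in B k F" "recursive_in B k G" "\<And>xs. G xs > 0"
  shows "recursive_in B k (\<lambda>xs. F xs div G xs)"
proof -
  \<comment> \<open>The quotient counts the positive multiples of \<open>y\<close> up to
    \<open>x\<close>; as \<open>y > 0\<close>, there are at most \<open>x\<close> of them, so a
    bounded sum finds all.\<close>
  have "(\<Sum>i<x. of_bool (Suc i * y \<le> x)) = x div y" if "y > 0" for x y :: nat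
  proof -
    have "Suc i * y \<le> x \<longleftrightarrow> i < x div y" for i
      by (metis Suc_le_eq less_eq_div_iff_mult_less_eq that)
    then have "{i. i < x \<and> Suc i * y \<le> x} = {i. i < x \<and> i < x div y}"
      by (simp only:)
    also have "\<dots> = {..<x div y}"
      using less_le_trans[OF _ div_le_dividend[of x y]] by blast
    finally have "{i. i < x \<and> Suc i * y \<le> x} = {..<x div y}" .
    moreover have "{..<x} \<inter> {i. Suc i * y \<le> x} = {i. i < x \<and> Suc i * y \<le> x}" by auto
    ultimately show ?thesis by (simp del: mult_Suc)
  qed
  with assms(3) have *: "(\<Sum>i<F xs. of_bool (Suc i * G xs \<le> F xs)) = F xs div G xs" for xs by blast
  have "recursive_in B (Suc k) (\<lambda>ys. of_bool (Suc (ys ! 0) * G (drop 1 ys) \<le> F (drop 1 ys)))"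
    using recursive_in_drop[OF assms(1), of 1] recursive_in_drop[OF assms(2), of 1]
    by (intro recursive_in_le recursive_in_mult recursive_in_Suc recursive_in_nth) simp_all
  from recursive_in_sum[OF assms(1) this] show ?thesis by (simp add: * del: mult_Suc)
qed

lemma recursive_in_mod:
  assumes "recursive_in B k F" "recursive_in B k G" "\<And>xs. G xs > 0"
  shows "recursive_in B k (\<lambda>xs. F xs mod G xs)"
proof -
  have "recursive_in B k (\<lambda>xs. F xs - F xs div G xs * G xs)"
    by (intro recursive_in_diff recursive_in_mult recursive_in_div assms)
  then show ?thesis by (simp add: minus_div_mult_eq_mod)
qed

lemma recursive_in_bit:
  assumes "recursive_in B k F" "recursive_in B k G"
  shows "recursive_in B k (\<lambda>xs. of_bool (bit (F xs) (G xs)))"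
proof -
  have "recursive_in B k (\<lambda>xs. (F xs div 2 ^ G xs) mod 2)"
    by (intro recursive_in_mod recursive_in_div recursive_in_power recursive_in_const assms) simp_all
  then show ?thesis by (simp add: bit_iff_odd mod_2_eq_odd)
qed

lemmas recursive_in_intros =
  recursive_in_const recursive_in_Suc recursive_in_oracle recursive_in_add recursive_in_mult
  recursive_in_power recursive_in_diff recursive_in_less recursive_in_not
  recursive_in_conj recursive_in_disj recursive_in_le recursive_in_eq
  recursive_in_if recursive_in_mod recursive_in_bit

section \<open>Bounded evaluation\<close>

text \<open>
  A total approximation to \<open>eval\<close>: the result \<open>0\<close> means undefined and \<open>Suc v\<close> the value \<open>v\<close>.
  The bits of \<open>c\<close> below \<open>m\<close> serve as the oracle, larger queries are undefined, and \<open>m\<close> also bounds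
  the searches. The state of the loop for \<open>Mu\<close> is \<open>0\<close> while searching, \<open>1\<close> after an undefined
  value, and \<open>i + 2\<close> once \<open>i\<close> has been found.
\<close>

fun bounded_eval :: "nat \<Rightarrow> nat \<Rightarrow> recf \<Rightarrow> nat list \<Rightarrow> nat" where
  "bounded_eval m c Zero xs = 1"
| "bounded_eval m c Succ xs = (if length xs = 1 then Suc (Suc (xs ! 0)) else 0)"
| "bounded_eval m c (Proj i) xs = (if i < length xs then Suc (xs ! i) else 0)"
| "bounded_eval m c Oracle xs = (if length xs = 1 \<and> xs ! 0 < m then Suc (of_bool (bit c (xs ! 0))) else 0)"
| "bounded_eval m c (Comp f gs) xs =
    (if \<exists>g\<in>set gs. bounded_eval m c g xs = 0 then 0
     else bounded_eval m c f (map (\<lambda>g. bounded_eval m c g xs - 1) gs))"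
| "bounded_eval m c (PrimRec f g) xs =
    (if xs = [] then 0
     else rec_nat (bounded_eval m c f (tl xs))
       (\<lambda>i r. if r = 0 then 0 else bounded_eval m c g (i # (r - 1) # tl xs)) (hd xs))"
| "bounded_eval m c (Mu f) xs =
    rec_nat 0 (\<lambda>i s. if s \<noteq> 0 then s else if bounded_eval m c f (i # xs) = 0 then 1
      else if bounded_eval m c f (i # xs) = 1 then i + 2 else 0) m - 1"

text \<open>Finite strings are pairs of a length and a number, so that recursive functions can range
  over them. Bits of \<open>c\<close> from \<open>m\<close> on are free; the code is unique only
  below \<open>2 ^ m\<close>.\<close>

definition codes_prefix :: "nat \<Rightarrow> nat \<Rightarrow> nat set \<Rightarrow> bool" where
  "codes_prefix m c B \<longleftrightarrow> (\<forall>i<m. bit c i \<longleftrightarrow> i \<in> B)"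

lemma bounded_eval_sound:
  assumes "codes_prefix m c B"
  shows "bounded_eval m c f xs = Suc y \<Longrightarrow> eval B f xs y"
proof (induction f arbitrary: xs y)
  case Zero
  then show ?case by (auto intro: eval.Zero)
next
  case Succ
  then show ?case by (auto simp: length_Suc_conv intro: eval.Succ split: if_splits)
next
  case (Proj i)
  then show ?case by (auto intro: eval.Proj split: if_splits)
next
  case Oracle
  then obtain x where x: "xs = [x]" "x < m" and y: "y = of_bool (bit c x)"
    by (auto simp: length_Suc_conv split: if_splits)
  with assms have "y = of_bool (x \<in> B)" by (simp add: codes_prefix_def)
  then show ?case by (simp only: x eval.Oracle)
next
  case (Comp f gs)
  let ?ys = "map (\<lambda>g. bounded_eval m c g xs - 1) gs"
  from Comp.prems have nz: "bounded_eval m c g xs \<noteq> 0" if "g \<in> set gs" for g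
    using that by (auto split: if_splits)
  with Comp.prems have "bounded_eval m c f ?ys = Suc y" by (auto split: if_splits)
  then have "eval B f ?ys y" by (rule Comp.IH(1))
  moreover have "list_all2 (\<lambda>g y. eval B g xs y) gs ?ys"
    using nz by (auto simp: list_all2_conv_all_nth intro!: Comp.IH(2))
  ultimately show ?case by (blast intro: eval.Comp)
next
  case (PrimRec f g)
  from PrimRec.prems obtain n zs where xs: "xs = n # zs" by (cases xs) auto
  have "rec_nat (bounded_eval m c f zs)
       (\<lambda>i r. if r = 0 then 0 else bounded_eval m c g (i # (r - 1) # zs)) n = Suc y \<Longrightarrow>
     eval B (PrimRec f g) (n # zs) y" for n y
  proof (induction n arbitrary: y)
    case 0
    then show ?case by (auto intro: eval.PrimRec_0 PrimRec.IH)
  next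
    case (Suc n)
    then show ?case
      by (auto intro!: eval.PrimRec_Suc PrimRec.IH simp: gr0_conv_Suc split: if_splits)
  qed
  with PrimRec.prems xs show ?case by (simp cong: if_cong)
next
  case (Mu f)
  define F where "F = (\<lambda>i s. if s \<noteq> 0 then s else if bounded_eval m c f (i # xs) = 0 then 1
      else if bounded_eval m c f (i # xs) = 1 then i + 2 else (0::nat))"
  \<comment> \<open>Loop invariant: while the search goes on, all earlier values are positive; a
    state \<open>n + 2\<close> certifies \<open>n\<close> as the result. State 1 promises
    nothing.\<close>
  have "(rec_nat 0 F k = 0 \<longrightarrow> (\<forall>i<k. \<exists>y. eval B f (i # xs) (Suc y))) \<and>
    (\<forall>n. rec_nat 0 F k = n + 2 \<longrightarrow> eval B (Mu f) xs n)" for k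
  proof (induction k)
    case 0
    show ?case by simp
  next
    case (Suc k)
    show ?case
    proof (cases "rec_nat 0 F k = 0")
      case True
      consider "bounded_eval m c f (k # xs) = 0" | "bounded_eval m c f (k # xs) = Suc 0"
        | y where "bounded_eval m c f (k # xs) = Suc (Suc y)"
        by (metis not0_implies_Suc)
      then show ?thesis
      proof cases
        case 1
        with True show ?thesis by (simp add: F_def)
      next
        case 2
        with True Suc Mu.IH[OF 2] show ?thesis by (auto simp: F_def intro: eval.Mu)
      next
        case 3
        with True Suc Mu.IH[OF 3] show ?thesis by (auto simp: F_def less_Suc_eq)
      qed
    next
      case False
      then have "rec_nat 0 F (Suc k) = rec_nat 0 F k" by (simp add: F_def)
      with Suc False show ?thesis by simp
    qed
  qed
  \<comment> \<open>The final \<open>- 1\<close> sends the states 0 and 1 both to undefined and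
    \<open>n + 2\<close> to \<open>Suc n\<close>.\<close>
  moreover have "rec_nat 0 F m = y + 2" using Mu.prems by (simp add: F_def)
  ultimately show ?case by blast
qed

text \<open>A derivation is finite: it makes finitely many queries and searches, so every large
  \<open>m\<close> bounds them all. The threshold does not depend on \<open>c\<close>, and finitely
  many thresholds merge in the filter.\<close>

lemma bounded_eval_complete:
  "eval B f xs y \<Longrightarrow> \<forall>\<^sub>F m in sequentially. \<forall>c. codes_prefix m c B \<longrightarrow> bounded_eval m c f xs = Suc y"
proof (induction rule: eval.induct)
  case (Oracle x)
  show ?case
    using eventually_gt_at_top[of x] by eventually_elim (auto simp: codes_prefix_def)
next
  case (Comp xs gs ys f z)
  have len: "length gs = length ys" using Comp.IH(1) by (rule list_all2_lengthD)
  have "\<forall>\<^sub>F m in sequentially. \<forall>j\<in>{..<length gs}. \<forall>c. codes_prefix m c B \<longrightarrow>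
      bounded_eval m c (gs ! j) xs = Suc (ys ! j)"
    using Comp.IH(1) by (intro eventually_ball_finite) (auto simp: list_all2_conv_all_nth)
  with Comp.IH(2) show ?case
  proof eventually_elim
    case (elim m)
    show ?case
    proof (intro allI impI)
      fix c assume c: "codes_prefix m c B"
      have "map (\<lambda>g. bounded_eval m c g xs - 1) gs = ys"
        using elim(2) c len by (auto intro!: nth_equalityI)
      moreover have "\<not> (\<exists>g\<in>set gs. bounded_eval m c g xs = 0)"
        using elim(2) c by (auto simp: in_set_conv_nth)
      ultimately show "bounded_eval m c (Comp f gs) xs = Suc z" using elim(1) c by simp
    qed
  qed
next
  case (PrimRec_0 f xs y g)
  from PrimRec_0.IH show ?case by eventually_elim simp
next
  case (PrimRec_Suc f g n xs y z)
  from PrimRec_Suc.IH show ?case by eventually_elim (simp cong: if_cong)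
next
  case (Mu f n xs)
  \<comment> \<open>The values at the arguments below \<open>n\<close> are chosen before
    \<open>m\<close>, so that the \<open>n\<close> eventual statements combine into one.\<close>
  from Mu.IH(2) have "\<forall>i. \<exists>v. i < n \<longrightarrow> (\<forall>\<^sub>F m in sequentially. \<forall>c. codes_prefix m c B \<longrightarrow>
      bounded_eval m c f (i # xs) = Suc (Suc v))"
    by blast
  from choice[OF this] obtain v where "\<forall>i. i < n \<longrightarrow> (\<forall>\<^sub>F m in sequentially. \<forall>c.
      codes_prefix m c B \<longrightarrow> bounded_eval m c f (i # xs) = Suc (Suc (v i)))"
    by blast
  then have "\<forall>\<^sub>F m in sequentially. \<forall>i\<in>{..<n}. \<forall>c. codes_prefix m c B \<longrightarrow> bounded_eval m c f (i # xs) = Suc (Suc (v i))"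
    by (intro eventually_ball_finite) auto
  with Mu.IH(1) eventually_gt_at_top[of n] show ?case
  proof eventually_elim
    case (elim m)
    show ?case
    proof (intro allI impI)
      fix c assume c: "codes_prefix m c B"
      define F where "F = (\<lambda>i s. if s \<noteq> 0 then s else if bounded_eval m c f (i # xs) = 0 then 1
          else if bounded_eval m c f (i # xs) = 1 then i + 2 else (0::nat))"
      have "rec_nat 0 F k = 0" if "k \<le> n" for k
        using that by (induction k) (use elim c in \<open>auto simp: F_def\<close>)
      then have "rec_nat 0 F n = 0" by simp
      then have found: "rec_nat 0 F (Suc n) = n + 2" using elim c by (simp add: F_def)
      have "rec_nat 0 F k = n + 2" if "Suc n \<le> k" for k
        using that
      proof (induction k rule: dec_induct)
        case base
        show ?case by (rule found)
      next
        case (step k)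
        then show ?case by (simp add: F_def)
      qed
      with elim(2) have "rec_nat 0 F m = n + 2" by simp
      then show "bounded_eval m c (Mu f) xs = Suc n" by (simp add: F_def)
    qed
  qed
qed auto

text \<open>The arguments are given as functions \<open>Gs\<close> of \<open>xs\<close>, and
  \<open>k\<close>, \<open>M\<close>, \<open>C\<close>, \<open>Gs\<close> vary in the induction:
  composition replaces the arguments by results, and loops add two variables. Tests on the number of
  arguments depend on \<open>Gs\<close> alone and are decided outside the recursion.\<close>

lemma recursive_in_bounded_eval:
  assumes "recursive_in B k M" "recursive_in B k C" "\<And>G. G \<in> set Gs \<Longrightarrow> recursive_in B k G"
  shows "recursive_in B k (\<lambda>xs. bounded_eval (M xs) (C xs) f (map (\<lambda>G. G xs) Gs))"
  using assms
proof (induction f arbitrary: k M C Gs)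
  case Zero
  then show ?case by (simp add: recursive_in_const)
next
  case Succ
  show ?case
  proof (cases "length Gs = 1")
    case True
    then obtain G where "Gs = [G]" by (auto simp: length_Suc_conv)
    with Succ show ?thesis by (auto intro: recursive_in_Suc)
  qed (simp add: recursive_in_const)
next
  case (Proj i)
  then show ?case by (cases "i < length Gs") (auto intro: recursive_in_Suc recursive_in_const)
next
  case Oracle
  show ?case
  proof (cases "length Gs = 1")
    case True
    then obtain G where "Gs = [G]" by (auto simp: length_Suc_conv)
    with Oracle show ?thesis
      by (simp cong: if_cong) (intro recursive_in_intros; simp)
  qed (simp add: recursive_in_const)
next
  case (Comp f gs)
  let ?V = "\<lambda>g xs. bounded_eval (M xs) (C xs) g (map (\<lambda>G. G xs) Gs)"
  have V: "recursive_in B k (?V g)" if "g \<in> set gs" for g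
    using Comp.IH(2)[OF that Comp.prems] by blast
  have "recursive_in B k (\<lambda>xs. bounded_eval (M xs) (C xs) f (map (\<lambda>G. G xs) (map (\<lambda>g xs. ?V g xs - 1) gs)))"
    using Comp.prems V by (intro Comp.IH(1)) (auto intro!: recursive_in_pred simp del: One_nat_def)
  moreover have "recursive_in B k (\<lambda>xs. of_bool (\<exists>g\<in>set gs. ?V g xs = 0))"
    using V by (intro recursive_in_Bex_list recursive_in_eq recursive_in_const)
  ultimately have "recursive_in B k (\<lambda>xs. if \<exists>g\<in>set gs. ?V g xs = 0 then 0 else
      bounded_eval (M xs) (C xs) f (map (\<lambda>G. G xs) (map (\<lambda>g xs. ?V g xs - 1) gs)))"
    by (intro recursive_in_if recursive_in_const)
  then show ?case by (simp add: comp_def cong: if_cong)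
next
  case (PrimRec f g)
  show ?case
  proof (cases Gs)
    case Nil
    then show ?thesis by (simp add: recursive_in_const)
  next
    case (Cons N Hs)
    \<comment> \<open>The loop body: counter and accumulator sit at positions 0 and 1, everything
      else is read from \<open>drop 2\<close>. The accumulator is a result shifted by one, hence
      \<open>ys ! 1 - 1\<close>.\<close>
    define G where "G = (\<lambda>ys. if ys ! 1 = 0 then 0 else
        bounded_eval (M (drop 2 ys)) (C (drop 2 ys)) g (map (\<lambda>H. H ys)
          ((\<lambda>ys. ys ! 0) # (\<lambda>ys. ys ! 1 - 1) # map (\<lambda>H ys. H (drop 2 ys)) Hs)))"
    have "recursive_in B (Suc (Suc k)) G"
      unfolding G_def using PrimRec.prems
      by (intro recursive_in_if recursive_in_eq recursive_in_const recursive_in_nth PrimRec.IH recursive_in_drop2)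
        (auto simp: Cons intro!: recursive_in_nth recursive_in_pred recursive_in_drop2 simp del: One_nat_def)
    moreover have "recursive_in B k (\<lambda>xs. bounded_eval (M xs) (C xs) f (map (\<lambda>G. G xs) Hs))"
      using PrimRec.prems by (intro PrimRec.IH) (auto simp: Cons)
    moreover have "recursive_in B k N" using PrimRec.prems by (simp add: Cons)
    ultimately have "recursive_in B k (\<lambda>xs. rec_nat (bounded_eval (M xs) (C xs) f (map (\<lambda>G. G xs) Hs))
        (\<lambda>n y. G (n # y # xs)) (N xs))"
      by (intro recursive_in_rec_nat)
    then show ?thesis by (simp add: Cons G_def comp_def cong: if_cong)
  qed
next
  case (Mu f)
  define V where "V = (\<lambda>ys. bounded_eval (M (drop 2 ys)) (C (drop 2 ys)) f (map (\<lambda>H. H ys)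
      ((\<lambda>ys. ys ! 0) # map (\<lambda>H ys. H (drop 2 ys)) Gs)))"
  have V: "recursive_in B (Suc (Suc k)) V"
    unfolding V_def using Mu.prems
    by (intro Mu.IH recursive_in_drop2) (auto intro!: recursive_in_nth recursive_in_drop2)
  define G where "G = (\<lambda>ys. if ys ! 1 \<noteq> 0 then ys ! 1 else if V ys = 0 then 1
      else if V ys = 1 then ys ! 0 + 2 else 0)"
  have "recursive_in B (Suc (Suc k)) G"
    unfolding G_def by (intro recursive_in_intros V recursive_in_nth) auto
  then have "recursive_in B k (\<lambda>xs. rec_nat 0 (\<lambda>n y. G (n # y # xs)) (M xs) - 1)"
    using Mu.prems by (intro recursive_in_pred recursive_in_rec_nat recursive_in_const)
  then show ?case by (simp add: G_def V_def comp_def cong: if_cong)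
qed

lemma turing_reducible_if_search:
  assumes "recursive_in B 2 (\<lambda>xs. of_bool (P (xs ! 0) (xs ! 1)))"
    and "recursive_in B 2 (\<lambda>xs. of_bool (Q (xs ! 0) (xs ! 1)))"
    and "\<And>n. \<exists>t. P t n"
    and "\<And>t n. P t n \<Longrightarrow> Q t n \<longleftrightarrow> n \<in> A"
  shows "A \<le>\<^sub>T B"
proof -
  \<comment> \<open>\<open>Mu\<close> searches for a zero, hence the negation of
    \<open>P\<close>.\<close>
  obtain g where g: "\<And>xs. length xs = 2 \<Longrightarrow> eval B g xs (of_bool (\<not> P (xs ! 0) (xs ! 1)))"
    using recursive_in_not[OF assms(1)] unfolding recursive_in_def by blast
  obtain h where h: "\<And>xs. length xs = 2 \<Longrightarrow> eval B h xs (of_bool (Q (xs ! 0) (xs ! 1)))"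
    using assms(2) unfolding recursive_in_def by blast
  have "eval B (Comp h [Mu g, Proj 0]) [n] (of_bool (n \<in> A))" for n
  proof -
    define t where "t = (LEAST t. P t n)"
    have t: "P t n" unfolding t_def using assms(3) by (rule LeastI_ex)
    have "\<not> P s n" if "s < t" for s using that unfolding t_def by (rule not_less_Least)
    then have "eval B g [s, n] (Suc 0)" if "s < t" for s
      using g[of "[s, n]"] that by simp
    moreover have "eval B g [t, n] 0" using g[of "[t, n]"] t by simp
    ultimately have "eval B (Mu g) [n] t" by (blast intro: eval.Mu)
    moreover have "eval B (Proj 0) [n] n" using eval.Proj[of 0 "[n]"] by simp
    moreover have "eval B h [t, n] (of_bool (n \<in> A))" using h[of "[t, n]"] assms(4)[OF t] by simp
    ultimately show ?thesis by (intro eval.Comp[where ys = "[t, n]"]) simp_all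
  qed
  then show ?thesis unfolding turing_reducible_def by blast
qed

section \<open>Cylinders and the Bernoulli measure\<close>

instance recf :: countable
  by countable_datatype

lemma space_bernoulli_measure [simp]: "space (bernoulli_measure p) = UNIV"
  by (simp add: bernoulli_measure_def space_PiM)

lemma prob_space_bernoulli_measure: "prob_space (bernoulli_measure p)"
  unfolding bernoulli_measure_def by (intro prob_space_PiM measure_pmf.prob_space_axioms)

definition cylinder :: "nat \<Rightarrow> nat \<Rightarrow> (nat \<Rightarrow> bool) set" where
  "cylinder m c = {A. codes_prefix m c {n. A n}}"

text \<open>The weights of the bits 1 and 0 are independent parameters because the rational lower
  approximations of \<open>p\<close> and \<open>1 - p\<close> do not add up to 1.\<close>

definition string_weight :: "real \<Rightarrow> real \<Rightarrow> nat \<Rightarrow> nat \<Rightarrow> real" where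
  "string_weight x y m c = (\<Prod>i<m. if bit c i then x else y)"

lemma cylinder_eq_prod_emb:
  "cylinder m c = prod_emb UNIV (\<lambda>_. measure_pmf (bernoulli_pmf p)) {..<m} (Pi\<^sub>E {..<m} (\<lambda>i. {bit c i}))"
  unfolding cylinder_def codes_prefix_def prod_emb_def
  by (intro set_eqI) (simp add: PiE_iff space_PiM extensional_def restrict_def, blast)

lemma sets_cylinder [measurable]: "cylinder m c \<in> sets (bernoulli_measure p)"
  unfolding bernoulli_measure_def cylinder_eq_prod_emb[of _ _ p] by (intro sets_PiM_I) auto

lemma measure_cylinder:
  assumes "0 \<le> p" "p \<le> 1"
  shows "measure (bernoulli_measure p) (cylinder m c) = string_weight p (1 - p) m c"
proof -
  interpret product_prob_space "\<lambda>_. measure_pmf (bernoulli_pmf p)" "UNIV :: nat set"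
    by unfold_locales
  have "measure (bernoulli_measure p) (cylinder m c) = (\<Prod>i<m. pmf (bernoulli_pmf p) (bit c i))"
    unfolding bernoulli_measure_def cylinder_eq_prod_emb[of _ _ p]
    by (subst measure_PiM_emb) (auto simp: measure_pmf_single)
  also have "\<dots> = string_weight p (1 - p) m c"
    unfolding string_weight_def using assms by (intro prod.cong) auto
  finally show ?thesis .
qed

lemma ex_cylinder: "\<exists>c<2 ^ m. A \<in> cylinder m c"
proof -
  \<comment> \<open>The first \<open>m\<close> bits of \<open>A\<close> read as a binary numeral,
    lowest bit first.\<close>
  let ?c = "horner_sum of_bool (2::nat) (map A [0..<m])"
  have "?c < 2 ^ m" using horner_sum_of_bool_2_less[of "map A [0..<m]"] by simp
  moreover have "A \<in> cylinder m ?c"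
    by (auto simp: cylinder_def codes_prefix_def bit_horner_sum_bit_iff)
  ultimately show ?thesis by blast
qed

lemma cylinder_disjoint:
  assumes "c < 2 ^ m" "d < 2 ^ m" "A \<in> cylinder m c" "A \<in> cylinder m d"
  shows "c = d"
proof -
  have "take_bit m c = take_bit m d"
    using assms(3,4) by (auto simp: bit_eq_iff bit_take_bit_iff cylinder_def codes_prefix_def)
  with assms(1,2) show ?thesis by (simp add: take_bit_nat_eq_self)
qed

lemma measure_Union_cylinder:
  assumes "0 \<le> p" "p \<le> 1" "X \<subseteq> {..<2 ^ m}"
  shows "measure (bernoulli_measure p) (\<Union>c\<in>X. cylinder m c) = (\<Sum>c\<in>X. string_weight p (1 - p) m c)"
proof -
  interpret prob_space "bernoulli_measure p" by (rule prob_space_bernoulli_measure)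
  have "disjoint_family_on (cylinder m) X"
    using assms(3) cylinder_disjoint unfolding disjoint_family_on_def by blast
  moreover have "finite X" using assms(3) finite_subset by blast
  ultimately show ?thesis
    using finite_measure_finite_Union[of X "cylinder m"] assms
    by (simp add: measure_cylinder sets_cylinder image_subset_iff)
qed

text \<open>Expanding the power gives one monomial per string. The induction peels off the last bit:
  the codes below \<open>2 ^ Suc m\<close> are those below \<open>2 ^ m\<close> and their shifts by
  \<open>2 ^ m\<close>.\<close>

lemma sum_string_weight: "(\<Sum>c<2 ^ m. string_weight x y m c) = (x + y) ^ m"
proof (induction m)
  case 0
  show ?case by (simp add: string_weight_def)
next
  case (Suc m)
  have low: "string_weight x y (Suc m) c = string_weight x y m c * y" if "c < 2 ^ m" for c
  proof -
    have "\<not> bit c m" using that by (simp add: bit_iff_odd)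
    then show ?thesis by (simp add: string_weight_def)
  qed
  have high: "string_weight x y (Suc m) (c + 2 ^ m) = string_weight x y m c * x" if "c < 2 ^ m" for c
  proof -
    have "bit (c + 2 ^ m) m" using that by (simp add: bit_iff_odd)
    moreover have "bit (c + 2 ^ m) i = bit c i" if "i < m" for i
    proof -
      have "take_bit m (c + 2 ^ m) = take_bit m c" by (simp add: take_bit_eq_mod)
      then show ?thesis using that by (metis bit_take_bit_iff)
    qed
    ultimately show ?thesis by (simp add: string_weight_def)
  qed
  have "(\<Sum>c<2 ^ Suc m. string_weight x y (Suc m) c) =
      (\<Sum>c<2 ^ m. string_weight x y (Suc m) c) + (\<Sum>c<2 ^ m. string_weight x y (Suc m) (c + 2 ^ m))"
    using sum.nat_group[of "string_weight x y (Suc m)" "2 ^ m" 2]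
    by (simp add: numeral_2_eq_2 lessThan_Suc atLeast0LessThan[symmetric] sum.shift_bounds_nat_ivl[of _ 0, simplified] add.commute)
  also have "\<dots> = (\<Sum>c<2 ^ m. string_weight x y m c) * (x + y)"
    by (simp add: low high flip: sum_distrib_right) (simp add: algebra_simps)
  finally show ?case by (simp add: Suc)
qed

lemma string_weight_mono:
  assumes "0 \<le> x" "x \<le> x'" "0 \<le> y" "y \<le> y'"
  shows "string_weight x y m c \<le> string_weight x' y' m c"
  unfolding string_weight_def by (intro prod_mono) (use assms in auto)

text \<open>The loss is at most that over all strings, where the weights sum to \<open>(x + y)\<close> to the power \<open>m\<close>;
  it is small although the number of strings is exponential.\<close>

lemma string_weight_loss:
  assumes "0 \<le> x" "x \<le> x'" "0 \<le> y" "y \<le> y'" "x' + y' = 1" "X \<subseteq> {..<2 ^ m}"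
  shows "(\<Sum>c\<in>X. string_weight x' y' m c) - (\<Sum>c\<in>X. string_weight x y m c) \<le> real m * (1 - (x + y))"
proof -
  have "(\<Sum>c\<in>X. string_weight x' y' m c) - (\<Sum>c\<in>X. string_weight x y m c) =
      (\<Sum>c\<in>X. string_weight x' y' m c - string_weight x y m c)"
    by (simp add: sum_subtractf)
  also have "\<dots> \<le> (\<Sum>c<2 ^ m. string_weight x' y' m c - string_weight x y m c)"
    using assms by (intro sum_mono2) (auto simp: string_weight_mono)
  also have "\<dots> = 1 - (x + y) ^ m"
    by (simp add: sum_subtractf sum_string_weight assms)
  also have "\<dots> \<le> real m * (1 - (x + y))"
    using Bernoulli_inequality[of "x + y - 1" m] assms by (simp add: algebra_simps)
  finally show ?thesis .
qed

section \<open>Clopen subsets of Cantor space and approximation of measurable sets\<close>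

definition determined_by_prefix :: "nat \<Rightarrow> (nat \<Rightarrow> bool) set \<Rightarrow> bool" where
  "determined_by_prefix m C \<longleftrightarrow> (\<forall>A B. (\<forall>i<m. A i = B i) \<longrightarrow> A \<in> C \<longrightarrow> B \<in> C)"

lemma determined_by_prefix_mono:
  assumes "determined_by_prefix m C" "m \<le> n"
  shows "determined_by_prefix n C"
  unfolding determined_by_prefix_def
proof (intro allI impI)
  fix A B assume "\<forall>i<n. A i = B i" "A \<in> C"
  with assms(2) have "\<forall>i<m. A i = B i" by simp
  with assms(1) \<open>A \<in> C\<close> show "B \<in> C" unfolding determined_by_prefix_def by blast
qed

lemma determined_by_prefix_Compl:
  "determined_by_prefix m C \<Longrightarrow> determined_by_prefix m (- C)"
  unfolding determined_by_prefix_def by (metis Compl_iff)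

lemma determined_by_prefix_UN:
  "(\<And>i. i \<in> I \<Longrightarrow> determined_by_prefix m (C i)) \<Longrightarrow> determined_by_prefix m (\<Union>i\<in>I. C i)"
  unfolding determined_by_prefix_def by blast

lemma cylinder_subset_if_determined:
  assumes "determined_by_prefix m C" "A \<in> C" "A \<in> cylinder m c"
  shows "cylinder m c \<subseteq> C"
proof
  fix B assume "B \<in> cylinder m c"
  with assms(3) have "\<forall>i<m. A i = B i" by (auto simp: cylinder_def codes_prefix_def)
  with assms(1,2) show "B \<in> C" unfolding determined_by_prefix_def by blast
qed

lemma sets_determined_by_prefix:
  assumes "determined_by_prefix m C"
  shows "C \<in> sets (bernoulli_measure p)"
proof -
  have "C = (\<Union>c\<in>{c. c < 2 ^ m \<and> cylinder m c \<subseteq> C}. cylinder m c)"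
  proof (intro equalityI subsetI)
    fix A assume "A \<in> C"
    obtain c where "c < 2 ^ m" "A \<in> cylinder m c" using ex_cylinder by blast
    with cylinder_subset_if_determined[OF assms \<open>A \<in> C\<close>]
    show "A \<in> (\<Union>c\<in>{c. c < 2 ^ m \<and> cylinder m c \<subseteq> C}. cylinder m c)" by auto
  qed auto
  moreover have "\<dots> \<in> sets (bernoulli_measure p)" by (intro sets.finite_UN) auto
  ultimately show ?thesis by simp
qed

text \<open>The approximable sets contain the generators and form a sigma-algebra. For a countable
  union, cut off a tail of measure below \<open>\<epsilon> / 2\<close> and approximate each of the
  finitely many remaining sets.\<close>

lemma approximate_by_determined:
  assumes "S \<in> sets (bernoulli_measure p)" "\<epsilon> > 0"
  shows "\<exists>m C. determined_by_prefix m C \<and> measure (bernoulli_measure p) (sym_diff S C) < \<epsilon>"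
proof -
  interpret prob_space "bernoulli_measure p" by (rule prob_space_bernoulli_measure)
  let ?G = "{{f. f i \<in> A} |(i :: nat) (A :: bool set). True}"
  have sets_eq: "sets (bernoulli_measure p) = sigma_sets UNIV ?G"
    by (simp add: bernoulli_measure_def sets_PiM_single)
  from assms(1) have "S \<in> sigma_sets UNIV ?G" unfolding sets_eq .
  then show ?thesis using assms(2)
  proof (induction arbitrary: \<epsilon> rule: sigma_sets.induct)
    case (Basic a)
    then obtain i A where a: "a = {f. f i \<in> A}" by blast
    have "determined_by_prefix (Suc i) a" unfolding a determined_by_prefix_def by auto
    then show ?case using Basic.prems by (intro exI[of _ "Suc i"] exI[of _ a]) simp
  next
    case Empty
    have "determined_by_prefix 0 {}" by (simp add: determined_by_prefix_def)
    then show ?case using Empty.prems by (intro exI[of _ 0] exI[of _ "{}"]) simp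
  next
    case (Compl a)
    then obtain m C where C: "determined_by_prefix m C" "prob (sym_diff a C) < \<epsilon>" by blast
    have "sym_diff (UNIV - a) (- C) = sym_diff a C" by auto
    with C show ?case by (metis determined_by_prefix_Compl)
  next
    case (Union a)
    have a: "a i \<in> events" for i using Union.hyps unfolding sets_eq .
    have U: "(\<Union>i. a i) \<in> events" using a by blast
    let ?U = "\<lambda>N. \<Union>i<N. a i"
    have UN: "?U N \<in> events" for N using a by blast
    have "(\<lambda>N. prob (?U N)) \<longlonglongrightarrow> prob (\<Union>N. ?U N)"
      using UN by (intro finite_Lim_measure_incseq) (auto simp: incseq_def intro: less_le_trans)
    moreover have "(\<Union>N. ?U N) = (\<Union>i. a i)" by auto
    ultimately have "\<forall>\<^sub>F N in sequentially. prob (\<Union>i. a i) - \<epsilon> / 2 < prob (?U N)"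
      using Union.prems by (intro order_tendstoD(1)) auto
    then obtain N where N: "prob (\<Union>i. a i) - \<epsilon> / 2 < prob (?U N)"
      by (auto simp: eventually_sequentially)
    have tail: "prob ((\<Union>i. a i) - ?U N) < \<epsilon> / 2"
      using N by (subst finite_measure_Diff) (use U UN in auto)
    \<comment> \<open>The \<open>N\<close> errors then add up to at most
      \<open>\<epsilon> / 2\<close>; \<open>Suc N\<close> avoids division by zero.\<close>
    define \<delta> where "\<delta> = \<epsilon> / (2 * real (Suc N))"
    have "\<delta> > 0" using Union.prems by (simp add: \<delta>_def)
    then have "\<forall>i. \<exists>m C. determined_by_prefix m C \<and> prob (sym_diff (a i) C) < \<delta>"
      using Union.IH by blast
    then obtain m C where
      C: "\<And>i. determined_by_prefix (m i) (C i)" "\<And>i. prob (sym_diff (a i) (C i)) < \<delta>"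
      by metis
    have Cs: "C i \<in> events" for i using C(1) by (rule sets_determined_by_prefix)
    have "determined_by_prefix (\<Sum>i<N. m i) (\<Union>i<N. C i)"
      by (intro determined_by_prefix_UN determined_by_prefix_mono[OF C(1)] member_le_sum) auto
    moreover have "prob (sym_diff (\<Union>i. a i) (\<Union>i<N. C i)) < \<epsilon>"
    proof -
      have "prob (sym_diff (\<Union>i. a i) (\<Union>i<N. C i)) \<le>
          prob (((\<Union>i. a i) - ?U N) \<union> (\<Union>i<N. sym_diff (a i) (C i)))"
        using U UN a Cs by (intro finite_measure_mono; blast)
      also have "\<dots> \<le> prob ((\<Union>i. a i) - ?U N) + prob (\<Union>i<N. sym_diff (a i) (C i))"
        using U UN a Cs by (intro measure_Un_le) auto
      also have "prob (\<Union>i<N. sym_diff (a i) (C i)) \<le> (\<Sum>i<N. prob (sym_diff (a i) (C i)))"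
        using a Cs by (intro finite_measure_subadditive_finite) auto
      also have "\<dots> \<le> real N * \<delta>"
        using sum_bounded_above[of "{..<N}" "\<lambda>i. prob (sym_diff (a i) (C i))" \<delta>] C(2)
        by (simp add: less_imp_le)
      also have "\<dots> \<le> \<epsilon> / 2" using Union.prems by (simp add: \<delta>_def field_simps)
      finally show ?thesis using tail by linarith
    qed
    ultimately show ?case by blast
  qed
qed

text \<open>The sets \<open>G t\<close> need not increase. The points of \<open>S\<close> that lie
  in all \<open>G t\<close> from \<open>j\<close> on do increase with \<open>j\<close> and exhaust
  \<open>S\<close>, so continuity from below applies to them.\<close>

lemma (in finite_measure) eventually_measure_gt:
  assumes S: "S \<in> sets M" and G: "\<And>t. G t \<in> sets M"
    and ev: "\<And>x. x \<in> S \<Longrightarrow> \<forall>\<^sub>F t in sequentially. x \<in> G t" and "\<theta> < measure M S"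
  shows "\<forall>\<^sub>F t in sequentially. \<theta> < measure M (G t)"
proof -
  define H where "H = (\<lambda>j. S \<inter> (\<Inter>t\<in>{j..}. G t))"
  have H: "H j \<in> sets M" for j
    unfolding H_def using S G by (intro sets.Int sets.countable_INT') auto
  have "(\<Union>j. H j) = S"
    using ev unfolding H_def eventually_sequentially by fastforce
  moreover have "incseq H" unfolding incseq_def H_def by (auto dest: order_trans)
  ultimately have "(\<lambda>j. measure M (H j)) \<longlonglongrightarrow> measure M S"
    using finite_Lim_measure_incseq[of H] H by (simp add: image_subset_iff)
  then have "\<forall>\<^sub>F j in sequentially. \<theta> < measure M (H j)" using assms(4) by (rule order_tendstoD)
  moreover have "measure M (H j) \<le> measure M (G j)" for j
    using G by (intro finite_measure_mono) (auto simp: H_def)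
  ultimately show ?thesis by (auto elim!: eventually_mono intro: less_le_trans)
qed

text \<open>The use principle: a computation depends on a finite part of its oracle. It makes the
  oracles giving a fixed result a countable union of cylinders, hence measurable.\<close>

lemma eval_iff_cylinder:
  "eval {n. A n} f xs y \<longleftrightarrow> (\<exists>m c. bounded_eval m c f xs = Suc y \<and> A \<in> cylinder m c)"
proof
  assume "eval {n. A n} f xs y"
  then obtain m where "\<And>c. codes_prefix m c {n. A n} \<Longrightarrow> bounded_eval m c f xs = Suc y"
    using bounded_eval_complete[of "{n. A n}" f xs y] unfolding eventually_sequentially by blast
  then show "\<exists>m c. bounded_eval m c f xs = Suc y \<and> A \<in> cylinder m c"
    using ex_cylinder[of m A] by (auto simp: cylinder_def)
qed (auto simp: cylinder_def intro: bounded_eval_sound)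

lemma sets_eval: "{A. eval {n. A n} f xs y} \<in> sets (bernoulli_measure p)"
proof -
  have "{A. eval {n. A n} f xs y} = (\<Union>m. \<Union>c\<in>{c. bounded_eval m c f xs = Suc y}. cylinder m c)"
    by (auto simp: eval_iff_cylinder)
  also have "\<dots> \<in> sets (bernoulli_measure p)" by (intro sets.countable_UN' ) auto
  finally show ?thesis .
qed

text \<open>There are countably many terms, and a countable union of null sets is null.\<close>

lemma positive_measure_functional:
  assumes "measure (bernoulli_measure p) {A. q \<le>\<^sub>T {n. A n}} > 0"
  shows "\<exists>f. measure (bernoulli_measure p) {A. \<forall>n. eval {n. A n} f [n] (of_bool (n \<in> q))} > 0"
proof (rule ccontr)
  interpret prob_space "bernoulli_measure p" by (rule prob_space_bernoulli_measure)
  let ?S = "\<lambda>f. {A. \<forall>n. eval {n. A n} f [n] (of_bool (n \<in> q))}"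
  have S: "?S f \<in> events" for f
  proof -
    have "?S f = (\<Inter>n. {A. eval {n. A n} f [n] (of_bool (n \<in> q))})"
      by (simp only: INT_iff[symmetric] Collect_all_eq)
    also have "\<dots> \<in> events" using sets_eval by (intro sets.countable_INT) auto
    finally show ?thesis .
  qed
  assume "\<not> (\<exists>f. prob (?S f) > 0)"
  then have "\<forall>f. prob (?S f) = 0" by (simp only: not_ex zero_less_measure_iff not_not simp_thms)
  then have "?S f \<in> null_sets (bernoulli_measure p)" for f
    using S by (intro null_setsI) (simp_all only: emeasure_eq_measure ennreal_0)
  then have "(\<Union>f. ?S f) \<in> null_sets (bernoulli_measure p)" by (rule null_sets_UN)
  moreover have "(\<Union>f. ?S f) = {A. q \<le>\<^sub>T {n. A n}}" by (auto simp: turing_reducible_def)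
  ultimately have "prob {A. q \<le>\<^sub>T {n. A n}} = 0" by (simp add: null_sets_def emeasure_eq_measure)
  with assms show False by simp
qed

section \<open>Majority vote\<close>

lemma floor_binary_expansion_Suc:
  assumes "0 \<le> p"
  shows "nat \<lfloor>2 ^ Suc n * p\<rfloor> = 2 * nat \<lfloor>2 ^ n * p\<rfloor> + of_bool (n \<in> binary_expansion p)"
proof -
  let ?y = "2 ^ n * p"
  have y: "?y \<ge> 0" using assms by simp
  have eq: "2 ^ Suc n * p = 2 * ?y" by simp
  have "\<lfloor>2 * ?y\<rfloor> = 2 * \<lfloor>?y\<rfloor> \<or> \<lfloor>2 * ?y\<rfloor> = 2 * \<lfloor>?y\<rfloor> + 1" by linarith
  moreover have "\<lfloor>?y\<rfloor> \<ge> 0" using y by simp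
  ultimately show ?thesis unfolding binary_expansion_def mem_Collect_eq eq
    by (elim disjE) (simp_all add: nat_add_distrib nat_mult_distrib)
qed

text \<open>The one place where the oracle is queried: each further bit of \<open>p\<close> doubles
  the floor and is added to it, starting from 0 because \<open>p < 1\<close>.\<close>

lemma recursive_in_floor:
  assumes "0 \<le> p" "p < 1" "recursive_in (binary_expansion p) k F"
  shows "recursive_in (binary_expansion p) k (\<lambda>xs. nat \<lfloor>2 ^ F xs * p\<rfloor>)"
proof -
  let ?B = "binary_expansion p"
  have "\<lfloor>p\<rfloor> = 0" using assms by linarith
  then have "rec_nat 0 (\<lambda>n y. 2 * y + of_bool (n \<in> ?B)) t = nat \<lfloor>2 ^ t * p\<rfloor>" for t
    by (induction t) (simp, simp only: floor_binary_expansion_Suc[OF assms(1)] nat.rec)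
  moreover have "recursive_in ?B (Suc (Suc k)) (\<lambda>ys. 2 * ys ! 1 + of_bool (ys ! 0 \<in> ?B))"
    by (intro recursive_in_intros recursive_in_nth) simp_all
  note recursive_in_rec_nat[OF assms(3) recursive_in_const[of _ _ 0] this]
  ultimately show ?thesis by simp
qed

text \<open>The numerator, over the denominator \<open>2 ^ (t * t)\<close>, of a lower bound for the measure of the
  cylinders coded by the \<open>c < 2 ^ t\<close> with \<open>X c\<close>: the probabilities of the two bits are
  replaced by their lower approximations with denominator \<open>2 ^ t\<close>.\<close>

definition lower_weight :: "real \<Rightarrow> nat \<Rightarrow> (nat \<Rightarrow> bool) \<Rightarrow> nat" where
  "lower_weight p t X = (\<Sum>c<2 ^ t. of_bool (X c) *
     (\<Prod>i<t. if bit c i then nat \<lfloor>2 ^ t * p\<rfloor> else 2 ^ t - Suc (nat \<lfloor>2 ^ t * p\<rfloor>)))"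

lemma lower_weight_bounds:
  fixes X :: "nat \<Rightarrow> bool" and t :: nat
  assumes "0 \<le> p" "p < 1"
  defines "\<mu> \<equiv> measure (bernoulli_measure p) (\<Union>c\<in>{c. c < 2 ^ t \<and> X c}. cylinder t c)"
  shows "real (lower_weight p t X) / 2 ^ (t * t) \<le> \<mu>"
    and "\<mu> \<le> real (lower_weight p t X) / 2 ^ (t * t) + real t / 2 ^ t"
proof -
  let ?K = "{c. c < 2 ^ t \<and> X c}"
  define P where "P = nat \<lfloor>2 ^ t * p\<rfloor>"
  define x where "x = real P / 2 ^ t"
  \<comment> \<open>Subtracting \<open>Suc P\<close> instead of \<open>P\<close> keeps
    \<open>y\<close> below \<open>1 - p\<close>, at the price that \<open>x + y\<close> falls short
    of 1 by exactly \<open>1 / 2 ^ t\<close>. By \<open>string_weight_loss\<close> the total error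
    is at most \<open>t / 2 ^ t\<close>, whatever \<open>X\<close> is.\<close>
  define y where "y = (2 ^ t - real (Suc P)) / 2 ^ t"
  have "0 \<le> \<lfloor>2 ^ t * p\<rfloor>" using assms by simp
  then have P: "real P \<le> 2 ^ t * p" "2 ^ t * p < real P + 1"
    unfolding P_def by linarith+
  have "2 ^ t * p < 2 ^ t" using assms by simp
  with P(1) have "real P < 2 ^ t" by linarith
  then have "Suc P \<le> 2 ^ t" by (simp add: Suc_le_eq)
  then have y_eq: "y = real (2 ^ t - Suc P) / 2 ^ t" by (simp add: y_def of_nat_diff)
  have x: "0 \<le> x" "x \<le> p" using P by (simp_all add: x_def field_simps)
  have y: "0 \<le> y" "y \<le> 1 - p" 
    using P by (simp add: y_eq, simp add: y_def field_simps)
  have xy: "1 - (x + y) = 1 / 2 ^ t" by (simp add: x_def y_def field_simps)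
  have "string_weight x y t c =
      real (\<Prod>i<t. if bit c i then P else 2 ^ t - Suc P) / 2 ^ (t * t)" for c
  proof -
    have "string_weight x y t c = (\<Prod>i<t. real (if bit c i then P else 2 ^ t - Suc P) / 2 ^ t)"
      unfolding string_weight_def x_def y_eq by (intro prod.cong) auto
    then show ?thesis by (simp add: prod_dividef power_mult)
  qed
  then have "(\<Sum>c\<in>?K. string_weight x y t c) =
      (\<Sum>c\<in>?K. real (\<Prod>i<t. if bit c i then P else 2 ^ t - Suc P)) / 2 ^ (t * t)"
    by (simp add: sum_divide_distrib)
  also have "(\<Sum>c\<in>?K. real (\<Prod>i<t. if bit c i then P else 2 ^ t - Suc P)) =
      (\<Sum>c<2 ^ t. real (of_bool (X c) * (\<Prod>i<t. if bit c i then P else 2 ^ t - Suc P)))"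
    by (rule sum.mono_neutral_cong_left) auto
  also have "\<dots> = real (lower_weight p t X)"
    by (simp only: lower_weight_def P_def of_nat_sum)
  finally have low: "(\<Sum>c\<in>?K. string_weight x y t c) = real (lower_weight p t X) / 2 ^ (t * t)" .
  have \<mu>: "\<mu> = (\<Sum>c\<in>?K. string_weight p (1 - p) t c)"
    unfolding \<mu>_def using assms by (intro measure_Union_cylinder) auto
  show "real (lower_weight p t X) / 2 ^ (t * t) \<le> \<mu>"
    unfolding \<mu> low[symmetric] by (intro sum_mono string_weight_mono x y)
  have "\<mu> - (\<Sum>c\<in>?K. string_weight x y t c) \<le> real t * (1 - (x + y))"
    unfolding \<mu> by (intro string_weight_loss x y) auto
  then show "\<mu> \<le> real (lower_weight p t X) / 2 ^ (t * t) + real t / 2 ^ t"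
    by (simp add: low xy)
qed

lemma recursive_in_lower_weight:
  assumes "0 \<le> p" "p < 1" and T: "recursive_in (binary_expansion p) k T"
    and X: "recursive_in (binary_expansion p) (Suc k) (\<lambda>ys. of_bool (X (ys ! 0) (drop 1 ys)))"
  shows "recursive_in (binary_expansion p) k (\<lambda>xs. lower_weight p (T xs) (\<lambda>c. X c xs))"
proof -
  let ?B = "binary_expansion p"
  let ?P = "\<lambda>xs. nat \<lfloor>2 ^ T xs * p\<rfloor>"
  have P: "recursive_in ?B k ?P" using assms by (intro recursive_in_floor)
  have T1: "recursive_in ?B (Suc k) (\<lambda>ys. T (drop 1 ys))"
    using recursive_in_drop[OF T, of 1] by simp
  \<comment> \<open>Variables of the factor: the position \<open>zs ! 0\<close>, the string
    \<open>zs ! 1\<close>, then the parameters.\<close>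
  have "recursive_in ?B (Suc (Suc k)) (\<lambda>zs. if bit (zs ! 1) (zs ! 0) then ?P (drop 2 zs)
      else 2 ^ T (drop 2 zs) - Suc (?P (drop 2 zs)))"
    using recursive_in_drop2[OF P] recursive_in_drop2[OF T]
    by (intro recursive_in_intros recursive_in_nth) simp_all
  from recursive_in_mult[OF X recursive_in_prod[OF T1 this]]
  have "recursive_in ?B (Suc k) (\<lambda>ys. of_bool (X (ys ! 0) (drop 1 ys)) *
      (\<Prod>i<T (drop 1 ys). if bit (ys ! 0) i then ?P (drop 1 ys) else 2 ^ T (drop 1 ys) - Suc (?P (drop 1 ys))))"
    by (simp add: numeral_2_eq_2 cong: if_cong)
  from recursive_in_sum[OF _ this, of "\<lambda>xs. 2 ^ T xs"]
  show ?thesis unfolding lower_weight_def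
    using recursive_in_power[OF recursive_in_const T, of 2] by (simp cong: if_cong)
qed

theorem theorem4p9:
  fixes p :: real and q :: "nat set"
  assumes "0 < p" and "p < 1"
    and "measure (bernoulli_measure p) {A. q \<le>\<^sub>T {n. A n}} = 1"
  shows "q \<le>\<^sub>T binary_expansion p"
proof -
  interpret prob_space "bernoulli_measure p" by (rule prob_space_bernoulli_measure)
  obtain f where "prob {A. \<forall>n. eval {n. A n} f [n] (of_bool (n \<in> q))} > 0"
    using positive_measure_functional[of p q] assms(3) by auto
  then obtain S where S_eq: "S = {A. \<forall>n. eval {n. A n} f [n] (of_bool (n \<in> q))}" and S_pos: "prob S > 0"
    by blast
  \<comment> \<open>By convention \<open>measure\<close> is 0 on non-measurable sets.\<close>
  have S: "S \<in> events" using S_pos by (metis less_irrefl measure_notin_sets)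
  define \<delta> where "\<delta> = prob S"
  have "\<delta> / 3 > 0" using S_pos by (simp add: \<delta>_def)
  from approximate_by_determined[OF S this] obtain m C where
    C: "determined_by_prefix m C" and approx: "prob (sym_diff S C) < \<delta> / 3"
    by blast
  have Cs: "C \<in> events" by (rule sets_determined_by_prefix[OF C])
  have "prob (C - S) \<le> prob (sym_diff S C)" "prob (S - C) \<le> prob (sym_diff S C)"
    using S Cs by (auto intro!: finite_measure_mono)
  moreover have "prob S = prob (S - C) + prob (S \<inter> C)"
    using finite_measure_Diff'[OF S Cs] by simp
  ultimately have outside: "prob (C - S) < \<delta> / 3" and inside: "2 * \<delta> / 3 < prob (S \<inter> C)"
    using approx by (auto simp: \<delta>_def)
  \<comment> \<open>A rational threshold is a pair of constants \<open>a\<close>, \<open>b\<close>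
    of the program, so that comparing with it is arithmetic on natural numbers. It does not depend
    on \<open>n\<close>.\<close>
  obtain \<theta> where "\<theta> \<in> \<rat>" and \<theta>: "\<delta> / 3 < \<theta>" "\<theta> < 2 * \<delta> / 3"
    using Rats_dense_in_real[of "\<delta> / 3" "2 * \<delta> / 3"] \<open>\<delta> / 3 > 0\<close> by auto
  moreover have "\<bar>\<theta>\<bar> = \<theta>" using \<theta> \<open>\<delta> / 3 > 0\<close> by linarith
  ultimately obtain a b :: nat where b: "b > 0" and ab: "\<theta> = real a / real b"
    by (metis Rats_abs_nat_div_natE neq0_conv)

  define D where "D = {d. d < 2 ^ m \<and> cylinder m d \<subseteq> C}"
  have "finite D" by (simp add: D_def)
  \<comment> \<open>The string \<open>c\<close> of length \<open>t\<close> lies in \<open>C\<close>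
    and votes for \<open>v\<close> at \<open>n\<close>. For \<open>m \<le> t\<close> its prefix of
    length \<open>m\<close> is coded by \<open>c mod 2 ^ m\<close>.\<close>
  define X where "X = (\<lambda>t n v c. m \<le> t \<and> c mod 2 ^ m \<in> D \<and> bounded_eval t c f [n] = Suc v)"
  define V where "V = (\<lambda>t n v. \<Union>c\<in>{c. c < 2 ^ t \<and> X t n v c}. cylinder t c)"
  define passes where "passes = (\<lambda>t n v. a * 2 ^ (t * t) < b * lower_weight p t (X t n v))"
  have passes_iff: "passes t n v \<longleftrightarrow> \<theta> < real (lower_weight p t (X t n v)) / 2 ^ (t * t)" for t n v
  proof -
    have "passes t n v \<longleftrightarrow> real (a * 2 ^ (t * t)) < real (b * lower_weight p t (X t n v))"
      unfolding passes_def of_nat_less_iff ..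
    also have "\<dots> \<longleftrightarrow> \<theta> < real (lower_weight p t (X t n v)) / 2 ^ (t * t)"
      using b by (simp add: ab field_simps)
    finally show ?thesis .
  qed
  have V: "V t n v \<in> events" for t n v unfolding V_def by (intro sets.finite_UN) auto
  have cylinder_mod: "cylinder t c \<subseteq> cylinder m (c mod 2 ^ m)" if "m \<le> t" for t c
    using that by (auto simp: cylinder_def codes_prefix_def bit_take_bit_iff simp flip: take_bit_eq_mod)

  have V_sub: "V t n v \<subseteq> C \<inter> {A. eval {n. A n} f [n] v}" for t n v
  proof
    fix A assume "A \<in> V t n v"
    then obtain c where c: "X t n v c" "A \<in> cylinder t c" unfolding V_def by blast
    with cylinder_mod have "A \<in> C" by (auto simp: X_def D_def)
    with c show "A \<in> C \<inter> {A. eval {n. A n} f [n] v}"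
      by (auto simp: X_def cylinder_def intro: bounded_eval_sound)
  qed
  \<comment> \<open>An oracle voting for a wrong value is outside \<open>S\<close>, as
    \<open>eval\<close> is deterministic; so wrong votes stay within \<open>C - S\<close>, and their
    lower bounds never exceed \<open>\<theta>\<close>.\<close>
  have sound: "v = of_bool (n \<in> q)" if "passes t n v" for t n v
  proof (rule ccontr)
    assume neq: "v \<noteq> of_bool (n \<in> q)"
    have "V t n v \<subseteq> C - S"
    proof
      fix A assume "A \<in> V t n v"
      with V_sub have "A \<in> C" "eval {n. A n} f [n] v" by blast+
      with neq eval_deterministic show "A \<in> C - S" unfolding S_eq by blast
    qed
    then have "prob (V t n v) \<le> prob (C - S)"
      using S Cs by (intro finite_measure_mono) auto
    moreover have "real (lower_weight p t (X t n v)) / 2 ^ (t * t) \<le> prob (V t n v)"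
      unfolding V_def using assms by (intro lower_weight_bounds) auto
    ultimately show False using that outside \<theta> unfolding passes_iff by linarith
  qed
  have complete: "\<exists>t. passes t n (of_bool (n \<in> q))" for n
  proof -
    let ?v = "of_bool (n \<in> q) :: nat"
    have ev: "\<forall>\<^sub>F t in sequentially. A \<in> V t n ?v" if A: "A \<in> S \<inter> C" for A
    proof -
      from A have "eval {n. A n} f [n] ?v" unfolding S_eq by blast
      from bounded_eval_complete[OF this] eventually_ge_at_top[of m] show ?thesis
      proof eventually_elim
        case (elim t)
        obtain c where c: "c < 2 ^ t" "A \<in> cylinder t c" using ex_cylinder by blast
        with cylinder_mod elim(2) have "A \<in> cylinder m (c mod 2 ^ m)" by blast
        then have "cylinder m (c mod 2 ^ m) \<subseteq> C" 
          using A by (intro cylinder_subset_if_determined[OF C]) auto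
        moreover have "bounded_eval t c f [n] = Suc ?v"
          using elim(1) c(2) by (simp only: cylinder_def mem_Collect_eq)
        ultimately have "X t n ?v c" using elim(2) by (simp add: X_def D_def)
        with c show ?case unfolding V_def by blast
      qed
    qed
    \<comment> \<open>The slack above \<open>\<theta>\<close>, which eventually absorbs the rounding
      error \<open>t / 2 ^ t\<close>.\<close>
    define \<epsilon> where "\<epsilon> = 2 * \<delta> / 3 - \<theta>"
    have "\<epsilon> > 0" using \<theta> by (simp add: \<epsilon>_def)
    have "S \<inter> C \<in> events" using S Cs by blast
    from eventually_measure_gt[OF this V ev inside]
    have "\<forall>\<^sub>F t in sequentially. 2 * \<delta> / 3 < prob (V t n ?v)" .
    moreover have "(\<lambda>t. real t / 2 ^ t) \<longlonglongrightarrow> 0" by real_asymp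
    then have "\<forall>\<^sub>F t in sequentially. real t / 2 ^ t < \<epsilon>"
      using \<open>\<epsilon> > 0\<close> by (rule order_tendstoD)
    ultimately have "\<forall>\<^sub>F t in sequentially. passes t n ?v"
    proof eventually_elim
      case (elim t)
      have "prob (V t n ?v) \<le> real (lower_weight p t (X t n ?v)) / 2 ^ (t * t) + real t / 2 ^ t"
        unfolding V_def using assms by (intro lower_weight_bounds) auto
      with elim show ?case unfolding passes_iff \<epsilon>_def by linarith
    qed
    then show ?thesis unfolding eventually_sequentially by blast
  qed

  have rec: "recursive_in (binary_expansion p) 2 (\<lambda>xs. of_bool (passes (xs ! 0) (xs ! 1) v))" for v
  proof -
    let ?B = "binary_expansion p"
    \<comment> \<open>The variables are string, length and input, the string in front as the
      summation in \<open>lower_weight\<close> requires. \<open>D\<close> is a fixed finite set, so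
      membership is a finite disjunction.\<close>
    have "recursive_in ?B 3 (\<lambda>ys. of_bool (\<exists>d\<in>set (sorted_list_of_set D). ys ! 0 mod 2 ^ m = d))"
      by (intro recursive_in_Bex_list recursive_in_intros recursive_in_nth) simp_all
    then have D: "recursive_in ?B 3 (\<lambda>ys. of_bool (ys ! 0 mod 2 ^ m \<in> D))"
      using \<open>finite D\<close> by simp
    have "recursive_in ?B 3 (\<lambda>ys. bounded_eval (ys ! 1) (ys ! 0) f (map (\<lambda>G. G ys) [\<lambda>ys. ys ! 2]))"
      by (intro recursive_in_bounded_eval) (auto intro: recursive_in_nth)
    then have "recursive_in ?B 3 (\<lambda>ys. bounded_eval (ys ! 1) (ys ! 0) f [ys ! 2])" by simp
    with D have "recursive_in ?B 3 (\<lambda>ys. of_bool (X (ys ! 1) (ys ! 2) v (ys ! 0)))"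
      unfolding X_def by (intro recursive_in_intros recursive_in_nth) simp_all
    then have "recursive_in ?B 3 (\<lambda>ys. of_bool (X (drop 1 ys ! 0) (drop 1 ys ! 1) v (ys ! 0)))"
      by (rule recursive_in_cong) (simp add: numeral_eq_Suc)
    then have "recursive_in ?B 2 (\<lambda>xs. lower_weight p (xs ! 0) (X (xs ! 0) (xs ! 1) v))"
      using assms by (intro recursive_in_lower_weight[where X = "\<lambda>c xs. X (xs ! 0) (xs ! 1) v c"] recursive_in_nth) auto
    then show ?thesis unfolding passes_def
      by (intro recursive_in_intros recursive_in_nth) simp_all
  qed
  show ?thesis
  \<comment> \<open>Search for a length at which one of the two answers passes, then test whether it
    was 1; by \<open>sound\<close> the two cannot both pass.\<close>
  proof (rule turing_reducible_if_search)
    show "recursive_in (binary_expansion p) 2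
        (\<lambda>xs. of_bool (passes (xs ! 0) (xs ! 1) 0 \<or> passes (xs ! 0) (xs ! 1) 1))"
      by (intro recursive_in_disj rec)
    show "recursive_in (binary_expansion p) 2 (\<lambda>xs. of_bool (passes (xs ! 0) (xs ! 1) 1))"
      by (rule rec)
    show "\<exists>t. passes t n 0 \<or> passes t n 1" for n
      using complete[of n] by (cases "n \<in> q") auto
    show "passes t n 1 \<longleftrightarrow> n \<in> q" if "passes t n 0 \<or> passes t n 1" for t n
      using that sound[of t n 0] sound[of t n 1] by (cases "n \<in> q") auto
  qed
qed

end
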